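(* Let $\Sigma=(\Sigma_c,\Sigma_r)$ and $\Delta=(\Delta_c,\Delta_r)$ be structured alphabets. Well-nested visibly pushdown transducers from $\Sigma$ to $\Delta$ and tail-recursive hedge-to-hedge transducers from $\Sigma_c\times\Sigma_r$ to $\Delta$ are equally expressive. That is: (1) for every well-nested visibly pushdown transducer $A$ from $\Sigma$ to $\Delta$ that does not accept the empty word, there exists a tail-recursive hedge-to-hedge transducer $T$ from $\Sigma_c\times\Sigma_r$ to $\Delta$ that does not accept the empty hedge, such that $A=T\circ\mathrm{hedge}$ (as relations between well-nested words over $\Sigma$ and words over $\Delta$); and (2) for every tail-recursive hedge-to-hedge transducer $T$ from $\Sigma_c\times\Sigma_r$ to $\Delta$ that does not accept the empty hedge, there exists a well-nested visibly pushdown transducer $A$ from $\Sigma$ to $\Delta$ that does not accept the empty word, such that $A=T\circ\mathrm{hedge}$.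
   Context: **Well-nested words.** A structured alphabet is a pair $\Sigma=(\Sigma_c,\Sigma_r)$ of disjoint finite alphabets (call and return symbols), identified with $\Sigma_c\cup\Sigma_r$. The set $\mathcal W_\Sigma$ of well-nested words is the least set of words over $\Sigma$ containing the empty word $\epsilon$, closed under concatenation, and such that $cwr\in\mathcal W_\Sigma$ whenever $w\in\mathcal W_\Sigma$, $c\in\Sigma_c$, $r\in\Sigma_r$. Every nonempty $w\in\mathcal W_\Sigma$ decomposes uniquely as $w=cw_1rw_2$ with $c\in\Sigma_c$, $r\in\Sigma_r$, $w_1,w_2\in\mathcal W_\Sigma$. **Hedges.** For a finite alphabet $\Lambda$, the set $\mathcal H_\Lambda$ of hedges over $\Lambda$ is the set of finite ordered sequences of unranked ordered $\Lambda$-labelled trees: a hedge is either the empty hedge $0$ or is uniquely of the form $f(h_1)\cdot h_2$ with $f\in\Lambda$ and $h_1,h_2\in\mathcal H_\Lambda$ (here $\cdot$ is associative concatenation with unit $0$). The map $\mathrm{hedge}:\mathcal W_\Sigma\to\mathcal H_{\Sigma_c\times\Sigma_r}$ is defined by $\mathrm{hedge}(\epsilon)=0$ and $\mathrm{hedge}(cw_1rw_2)=(c,r)(\mathrm{hedge}(w_1))\cdot\mathrm{hedge}(w_2)$. **Visibly pushdown transducers.** A visibly pushdown transducer from $\Sigma$ to $\Delta$ is a tuple $A=(Q,I,F,\Gamma,\delta)$ with $Q$ a finite set of states, $I,F\subseteq Q$ the initial and final states, $\Gamma$ a finite stack alphabet, $\bot\notin\Gamma$ the bottom stack symbol, and $\delta=\delta_c\uplus\delta_r$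 finite, where $\delta_c\subseteq Q\times\Sigma_c\times\Gamma\times\Delta^*\times Q$ (call transitions) and $\delta_r\subseteq Q\times\Sigma_r\times\Gamma\times\Delta^*\times Q$ (return transitions). A configuration is a pair $(q,\sigma)$ with $q\in Q$, $\sigma\in\bot\Gamma^*$. A call transition $(q,a,\gamma,v,q')$ reads $a$, outputs $v$, and goes from $(q,\sigma)$ to $(q',\sigma\gamma)$; a return transition $(q,a,\gamma,v,q')$ reads $a$, outputs $v$, and goes from $(q,\sigma\gamma)$ to $(q',\sigma)$. A run on a word is a sequence of transitions reading its letters in order; its output is the concatenation of the outputs of its transitions ($\epsilon$ for the empty run). A run is accepting if it goes from some $(q,\bot)$ with $q\in I$ to some $(q',\bot)$ with $q'\in F$. $A$ is identified with the relation of pairs $(u,v)$ such that there is an accepting run on $u$ with output $v$; this relation is included in $\mathcal W_\Sigma\times\Delta^*$. For $\Delta$ structured, $A$ is well-nested if for all $\gamma\in\Gamma$ and all transitions $(q,c,\gamma,v,q')\in\delta_c$ and $(p,r,\gamma,v',p')\in\delta_r$, one has $vv'\in\mathcal W_\Delta$. **Hedge-to-string and hedge-to-hedge transducers.** A hedge-to-string transducer from $\Lambda$ to $\Delta$ is a tuple $T=(Q,I,\delta)$ with $Q$ a finite set of states, $I\subseteq Q$ the initial states, and $\delta$ a finite set of rules of the forms $$q(0)\to\epsilon,\qquad q(f(x_1)\cdot x_2)\to w_1q_1(x_1)w_2q_2(x_2)w_3,$$ with $q,q_1,q_2\in Q$, $f\in\Lambda$, $w_1,w_2,w_3\in\Delta^*$.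 Its semantics is given by maps $[\![q]\!]:\mathcal H_\Lambda\to 2^{\Delta^*}$: $[\![q]\!](0)=\{\epsilon\}$ if $q(0)\to\epsilon\in\delta$ and $\emptyset$ otherwise; $[\![q]\!](f(h)\cdot h')$ is the union, over all rules $q(f(x_1)\cdot x_2)\to w_1q_1(x_1)w_2q_2(x_2)w_3$ in $\delta$, of $w_1\cdot[\![q_1]\!](h)\cdot w_2\cdot[\![q_2]\!](h')\cdot w_3$. $T$ is identified with the relation $\{(h,s)\mid\exists q\in I,\ s\in[\![q]\!](h)\}$. $T$ is tail-recursive if $w_3=\epsilon$ in every rule of the second form. For $\Delta$ structured, $T$ is a hedge-to-hedge transducer if $w_1w_2w_3\in\mathcal W_\Delta$ for every rule of the second form. A transducer accepts an input if the input is related to at least one output. $T\circ\mathrm{hedge}$ denotes the relation $\{(w,s)\mid w\in\mathcal W_\Sigma,\ (\mathrm{hedge}(w),s)\in T\}$. *)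

theory Defs
  imports Main
begin

section \<open>Structured alphabets and well-nested words\<close>

text \<open>A structured alphabet is the pair of its call symbols and its return symbols.\<close>

type_synonym 'a salph = "'a set \<times> 'a set"

abbreviation calls :: "'a salph \<Rightarrow> 'a set" where
  "calls \<equiv> fst"

abbreviation returns :: "'a salph \<Rightarrow> 'a set" where
  "returns \<equiv> snd"

definition symbols :: "'a salph \<Rightarrow> 'a set" where
  "symbols \<Sigma> = calls \<Sigma> \<union> returns \<Sigma>"

definition structured_alphabet :: "'a salph \<Rightarrow> bool" where
  "structured_alphabet \<Sigma> \<longleftrightarrow>
     finite (calls \<Sigma>) \<and> finite (returns \<Sigma>) \<and> calls \<Sigma> \<inter> returns \<Sigma> = {}"

inductive_set wn_words :: "'a salph \<Rightarrow> 'a list set" for \<Sigma> :: "'a salph" where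
  empty: "[] \<in> wn_words \<Sigma>"
| append: "u \<in> wn_words \<Sigma> \<Longrightarrow> v \<in> wn_words \<Sigma> \<Longrightarrow> u @ v \<in> wn_words \<Sigma>"
| wrap: "w \<in> wn_words \<Sigma> \<Longrightarrow> c \<in> calls \<Sigma> \<Longrightarrow> r \<in> returns \<Sigma> \<Longrightarrow> c # w @ [r] \<in> wn_words \<Sigma>"

lemma wn_words_decomp:
  assumes "w \<in> wn_words \<Sigma>" "w \<noteq> []"
  obtains c w1 r w2 where "c \<in> calls \<Sigma>" "r \<in> returns \<Sigma>" "w1 \<in> wn_words \<Sigma>" "w2 \<in> wn_words \<Sigma>"
    "w = c # w1 @ r # w2"
proof -
  have "w \<noteq> [] \<longrightarrow> (\<exists>c w1 r w2. c \<in> calls \<Sigma> \<and> r \<in> returns \<Sigma> \<and> w1 \<in> wn_words \<Sigma> \<and>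
      w2 \<in> wn_words \<Sigma> \<and> w = c # w1 @ r # w2)"
    using assms(1)
  proof induction
    case (append u v)
    show ?case
    proof (cases "u = []")
      case True
      then show ?thesis using append by simp
    next
      case False
      then obtain c w1 r w2 where u: "c \<in> calls \<Sigma>" "r \<in> returns \<Sigma>" "w1 \<in> wn_words \<Sigma>"
        "w2 \<in> wn_words \<Sigma>" "u = c # w1 @ r # w2"
        using append by blast
      have "w2 @ v \<in> wn_words \<Sigma>"
        using u(4) append.hyps(2) by (rule wn_words.append)
      moreover have "u @ v = c # w1 @ r # (w2 @ v)"
        using u(5) by simp
      ultimately show ?thesis using u(1-3) by blast
    qed
  next
    case (wrap w c r)
    then show ?case using wn_words.empty by blast
  qed simp
  with assms(2) that show ?thesis by blast
qed

definition height :: "'a salph \<Rightarrow> 'a list \<Rightarrow> int" where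
  "height \<Sigma> w = (\<Sum>a\<leftarrow>w. if a \<in> calls \<Sigma> then 1 else - 1)"

lemma height_simps [simp]:
  "height \<Sigma> [] = 0"
  "height \<Sigma> (a # w) = (if a \<in> calls \<Sigma> then 1 else - 1) + height \<Sigma> w"
  "height \<Sigma> (u @ v) = height \<Sigma> u + height \<Sigma> v"
  by (simp_all add: height_def)

lemma height_wn_words:
  assumes "structured_alphabet \<Sigma>" "w \<in> wn_words \<Sigma>"
  shows "height \<Sigma> w = 0 \<and> (\<forall>u v. w = u @ v \<longrightarrow> height \<Sigma> u \<ge> 0)"
  using assms(2)
proof induction
  case empty
  then show ?case by simp
next
  case (append u v)
  then show ?case by (auto simp: append_eq_append_conv2)
next
  case (wrap w c r)
  moreover have "r \<notin> calls \<Sigma>"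
    using wrap assms(1) by (auto simp: structured_alphabet_def)
  ultimately show ?case
    by (auto simp: Cons_eq_append_conv append_eq_append_conv2 append_eq_Cons_conv)
qed

lemma wn_words_decomp_unique:
  assumes "structured_alphabet \<Sigma>"
    and "w1 \<in> wn_words \<Sigma>" "w1' \<in> wn_words \<Sigma>" "r \<in> returns \<Sigma>" "r' \<in> returns \<Sigma>"
    and "c # w1 @ r # w2 = c' # w1' @ r' # w2'"
  shows "c = c' \<and> w1 = w1' \<and> r = r' \<and> w2 = w2'"
proof -
  have no_ext: False
    if "x = y @ s # z" "x \<in> wn_words \<Sigma>" "y \<in> wn_words \<Sigma>" "s \<in> returns \<Sigma>" for x y s z
  proof -
    have "height \<Sigma> (y @ [s]) \<ge> 0"
      using height_wn_words[OF assms(1) that(2)] that(1) by (metis append.assoc append_Cons append_Nil)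
    moreover have "height \<Sigma> y = 0"
      using height_wn_words[OF assms(1) that(3)] by simp
    moreover have "s \<notin> calls \<Sigma>"
      using that(4) assms(1) by (auto simp: structured_alphabet_def)
    ultimately show False by simp
  qed
  from assms(6) have "w1 @ r # w2 = w1' @ r' # w2'" by simp
  then obtain us where "w1 = w1' @ us \<and> us @ r # w2 = r' # w2' \<or> w1 @ us = w1' \<and> r # w2 = us @ r' # w2'"
    by (auto simp: append_eq_append_conv2)
  then have "w1 = w1'"
    using no_ext[of w1 w1' r'] no_ext[of w1' w1 r] assms(2-5) by (cases us) auto
  then show ?thesis using assms(6) by simp
qed


section \<open>Hedges\<close>

text \<open>A hedge is a list of unranked trees: the empty hedge is \<open>[]\<close> and $f(h_1) \cdot h_2$ is
  \<open>Tree f h\<^sub>1 # h\<^sub>2\<close>.\<close>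

datatype (labels: 'f) tree = Tree 'f "'f tree list"

type_synonym 'f hedge = "'f tree list"

definition hedges :: "'f set \<Rightarrow> 'f hedge set" where
  "hedges \<Lambda> = {h. \<forall>t \<in> set h. labels t \<subseteq> \<Lambda>}"

text \<open>The last equation only makes the function total; it concerns arguments outside the
  intended domain \<open>wn_words \<Sigma>\<close>, for \<open>\<Sigma>\<close> a structured alphabet.\<close>

function hedge :: "'a salph \<Rightarrow> 'a list \<Rightarrow> ('a \<times> 'a) hedge" where
  hedge_Nil: "hedge \<Sigma> [] = []"
| hedge_Cons: "structured_alphabet \<Sigma> \<Longrightarrow> c \<in> calls \<Sigma> \<Longrightarrow> r \<in> returns \<Sigma> \<Longrightarrow>
    w1 \<in> wn_words \<Sigma> \<Longrightarrow> w2 \<in> wn_words \<Sigma> \<Longrightarrow>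
    hedge \<Sigma> (c # w1 @ r # w2) = Tree (c, r) (hedge \<Sigma> w1) # hedge \<Sigma> w2"
| hedge_undefined: "w \<noteq> [] \<Longrightarrow> \<not> (structured_alphabet \<Sigma> \<and> w \<in> wn_words \<Sigma>) \<Longrightarrow> hedge \<Sigma> w = undefined"
proof (goal_cases)
  case (1 P x)
  then show ?case by (metis wn_words_decomp surj_pair)
next
  case (5 \<Sigma> c r w1 w2 \<Sigma>' c' r' w1' w2')
  then show ?case using wn_words_decomp_unique[of \<Sigma> w1 w1' r r' c w2 c' w2'] by simp
next
  case (6 \<Sigma> c r w1 w2 w \<Sigma>')
  then have "(c # w1 @ [r]) @ w2 \<in> wn_words \<Sigma>"
    by (intro wn_words.append wn_words.wrap)
  with 6 show ?case by simp
qed auto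
termination by (relation "measure (\<lambda>(\<Sigma>, w). length w)") auto


section \<open>Visibly pushdown transducers\<close>

text \<open>Transitions \<open>(q, a, \<gamma>, v, q')\<close> read \<open>a\<close>, push or pop \<open>\<gamma>\<close>, and output \<open>v\<close>.\<close>

record ('q, 'a, 'b, 'g) vpt =
  vpt_states :: "'q set"
  vpt_initial :: "'q set"
  vpt_final :: "'q set"
  vpt_stack :: "'g set"
  vpt_call :: "('q \<times> 'a \<times> 'g \<times> 'b list \<times> 'q) set"
  vpt_return :: "('q \<times> 'a \<times> 'g \<times> 'b list \<times> 'q) set"

definition is_vpt :: "'a salph \<Rightarrow> 'b set \<Rightarrow> ('q, 'a, 'b, 'g) vpt \<Rightarrow> bool" where
  "is_vpt \<Sigma> D A \<longleftrightarrow>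
     finite (vpt_states A) \<and> vpt_initial A \<subseteq> vpt_states A \<and> vpt_final A \<subseteq> vpt_states A \<and>
     finite (vpt_stack A) \<and> finite (vpt_call A) \<and> finite (vpt_return A) \<and>
     vpt_call A \<subseteq> vpt_states A \<times> calls \<Sigma> \<times> vpt_stack A \<times> lists D \<times> vpt_states A \<and>
     vpt_return A \<subseteq> vpt_states A \<times> returns \<Sigma> \<times> vpt_stack A \<times> lists D \<times> vpt_states A"

text \<open>The bottom symbol is left implicit: the list \<open>[\<gamma>\<^sub>n, \<dots>, \<gamma>\<^sub>1]\<close>, top of stack first,
  stands for the stack $\bot\gamma_1 \cdots \gamma_n$, and \<open>[]\<close> for $\bot$.\<close>

definition configs :: "('q, 'a, 'b, 'g) vpt \<Rightarrow> ('q \<times> 'g list) set" where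
  "configs A = vpt_states A \<times> lists (vpt_stack A)"

text \<open>\<open>run A C u v C'\<close>: there is a run on \<open>u\<close> with output \<open>v\<close> from \<open>C\<close> to \<open>C'\<close>.\<close>

inductive run :: "('q, 'a, 'b, 'g) vpt \<Rightarrow> 'q \<times> 'g list \<Rightarrow> 'a list \<Rightarrow> 'b list \<Rightarrow> 'q \<times> 'g list \<Rightarrow> bool"
  for A :: "('q, 'a, 'b, 'g) vpt" where
  run_empty: "C \<in> configs A \<Longrightarrow> run A C [] [] C"
| run_call: "(q, a, \<gamma>, v, q') \<in> vpt_call A \<Longrightarrow> run A (q', \<gamma> # \<sigma>) u v' C \<Longrightarrow>
    run A (q, \<sigma>) (a # u) (v @ v') C"
| run_return: "(q, a, \<gamma>, v, q') \<in> vpt_return A \<Longrightarrow> run A (q', \<sigma>) u v' C \<Longrightarrow>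
    run A (q, \<gamma> # \<sigma>) (a # u) (v @ v') C"

definition vpt_rel :: "('q, 'a, 'b, 'g) vpt \<Rightarrow> ('a list \<times> 'b list) set" where
  "vpt_rel A = {(u, v). \<exists>q \<in> vpt_initial A. \<exists>q' \<in> vpt_final A. run A (q, []) u v (q', [])}"

definition well_nested :: "'b salph \<Rightarrow> ('q, 'a, 'b, 'g) vpt \<Rightarrow> bool" where
  "well_nested \<Delta> A \<longleftrightarrow>
     (\<forall>\<gamma> \<in> vpt_stack A. \<forall>q c v q' p r v' p'.
        (q, c, \<gamma>, v, q') \<in> vpt_call A \<longrightarrow> (p, r, \<gamma>, v', p') \<in> vpt_return A \<longrightarrow>
        v @ v' \<in> wn_words \<Delta>)"


section \<open>Hedge-to-string and hedge-to-hedge transducers\<close>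

text \<open>\<open>Eps_Rule q\<close> is $q(0) \to \epsilon$, and \<open>Node_Rule q f w\<^sub>1 q\<^sub>1 w\<^sub>2 q\<^sub>2 w\<^sub>3\<close> is
  $q(f(x_1) \cdot x_2) \to w_1 q_1(x_1) w_2 q_2(x_2) w_3$.\<close>

datatype ('q, 'f, 'b) hst_rule =
    Eps_Rule 'q
  | Node_Rule 'q 'f "'b list" 'q "'b list" 'q "'b list"

record ('q, 'f, 'b) hst =
  hst_states :: "'q set"
  hst_initial :: "'q set"
  hst_rules :: "('q, 'f, 'b) hst_rule set"

definition is_hst :: "'f set \<Rightarrow> 'b set \<Rightarrow> ('q, 'f, 'b) hst \<Rightarrow> bool" where
  "is_hst \<Lambda> D T \<longleftrightarrow>
     finite (hst_states T) \<and> hst_initial T \<subseteq> hst_states T \<and> finite (hst_rules T) \<and>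
     (\<forall>q. Eps_Rule q \<in> hst_rules T \<longrightarrow> q \<in> hst_states T) \<and>
     (\<forall>q f w1 q1 w2 q2 w3. Node_Rule q f w1 q1 w2 q2 w3 \<in> hst_rules T \<longrightarrow>
        q \<in> hst_states T \<and> q1 \<in> hst_states T \<and> q2 \<in> hst_states T \<and> f \<in> \<Lambda> \<and>
        w1 \<in> lists D \<and> w2 \<in> lists D \<and> w3 \<in> lists D)"

fun hst_sem :: "('q, 'f, 'b) hst \<Rightarrow> 'q \<Rightarrow> 'f hedge \<Rightarrow> 'b list set" where
  "hst_sem T q [] = (if Eps_Rule q \<in> hst_rules T then {[]} else {})"
| "hst_sem T q (Tree f h # h') =
     {w1 @ s @ w2 @ s' @ w3 | w1 q1 w2 q2 w3 s s'.
        Node_Rule q f w1 q1 w2 q2 w3 \<in> hst_rules T \<and> s \<in> hst_sem T q1 h \<and> s' \<in> hst_sem T q2 h'}"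

definition hst_rel :: "('q, 'f, 'b) hst \<Rightarrow> ('f hedge \<times> 'b list) set" where
  "hst_rel T = {(h, s). \<exists>q \<in> hst_initial T. s \<in> hst_sem T q h}"

text \<open>\<open>hst_sem\<close> is defined on all hedges over the label type, but for a transducer from \<open>\<Lambda>\<close>
  it is empty outside \<open>hedges \<Lambda>\<close>.\<close>

lemma hst_sem_hedges:
  assumes "is_hst \<Lambda> D T"
  shows "s \<in> hst_sem T q h \<Longrightarrow> h \<in> hedges \<Lambda> \<and> s \<in> lists D"
  using assms
proof (induction T q h arbitrary: s rule: hst_sem.induct)
  case (1 T q)
  then show ?case by (auto simp: hedges_def split: if_splits)
next
  case (2 T q f h h')
  from 2(3) obtain w1 q1 w2 q2 w3 s1 s2 where
    r: "Node_Rule q f w1 q1 w2 q2 w3 \<in> hst_rules T"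
    and s: "s = w1 @ s1 @ w2 @ s2 @ w3" "s1 \<in> hst_sem T q1 h" "s2 \<in> hst_sem T q2 h'"
    by auto
  have "f \<in> \<Lambda>" "w1 \<in> lists D" "w2 \<in> lists D" "w3 \<in> lists D"
    using 2(4) r unfolding is_hst_def by blast+
  moreover have "h \<in> hedges \<Lambda> \<and> s1 \<in> lists D" "h' \<in> hedges \<Lambda> \<and> s2 \<in> lists D"
    using 2(1)[OF s(2) 2(4)] 2(2)[OF s(3) 2(4)] by auto
  ultimately show ?case
    using s(1) by (auto simp: hedges_def)
qed

lemma hst_rel_subset: "is_hst \<Lambda> D T \<Longrightarrow> hst_rel T \<subseteq> hedges \<Lambda> \<times> lists D"
  using hst_sem_hedges unfolding hst_rel_def by fast

definition tail_recursive :: "('q, 'f, 'b) hst \<Rightarrow> bool" where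
  "tail_recursive T \<longleftrightarrow>
     (\<forall>q f w1 q1 w2 q2 w3. Node_Rule q f w1 q1 w2 q2 w3 \<in> hst_rules T \<longrightarrow> w3 = [])"

definition hedge_to_hedge :: "'b salph \<Rightarrow> ('q, 'f, 'b) hst \<Rightarrow> bool" where
  "hedge_to_hedge \<Delta> T \<longleftrightarrow>
     (\<forall>q f w1 q1 w2 q2 w3. Node_Rule q f w1 q1 w2 q2 w3 \<in> hst_rules T \<longrightarrow>
        w1 @ w2 @ w3 \<in> wn_words \<Delta>)"

definition comp_hedge :: "'a salph \<Rightarrow> ('q, 'a \<times> 'a, 'b) hst \<Rightarrow> ('a list \<times> 'b list) set" where
  "comp_hedge \<Sigma> T = {(w, s). w \<in> wn_words \<Sigma> \<and> (hedge \<Sigma> w, s) \<in> hst_rel T}"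

definition accepts :: "('x \<times> 'y) set \<Rightarrow> 'x \<Rightarrow> bool" where
  "accepts R x \<longleftrightarrow> (\<exists>y. (x, y) \<in> R)"

end

theory Submission imports Defs
begin

text \<open>A run of a visibly pushdown transducer on \<open>c # w1 @ r # w2\<close> that starts and ends with the
  empty stack consists of a call, a run on \<open>w1\<close>, a return that pops the symbol pushed by the call, and a
  run on \<open>w2\<close>, where both runs may be taken to start and end with the empty stack. This is the
  shape of a tail-recursive node rule. A transducer \<open>A\<close> is therefore simulated by a hedge
  transducer whose states are the pairs (start, end) of states of \<open>A\<close>; conversely, a
  tail-recursive hedge transducer is simulated by pushing the applied rule, so that the matching
  return knows the remaining output and the state with which to continue.\<close>

section \<open>Well-nested words: induction along the decomposition, and insertion\<close>

text \<open>The \<open>append\<close> rule may split a word in many ways; this rule follows the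
  unique decomposition on which \<open>hedge\<close> recurses. Both \<open>w1\<close> and
  \<open>w2\<close> are shorter than the whole word, so induction on length suffices.\<close>

lemma wn_words_induct_Cons [consumes 1, case_names Nil Cons]:
  assumes "w \<in> wn_words \<Sigma>" and "P []"
    and "\<And>c r w1 w2. c \<in> calls \<Sigma> \<Longrightarrow> r \<in> returns \<Sigma> \<Longrightarrow> w1 \<in> wn_words \<Sigma> \<Longrightarrow> w2 \<in> wn_words \<Sigma> \<Longrightarrow>
      P w1 \<Longrightarrow> P w2 \<Longrightarrow> P (c # w1 @ r # w2)"
  shows "P w"
  using assms(1)
proof (induction w rule: length_induct)
  case (1 w)
  show ?case
  proof (cases "w = []")
    case True
    then show ?thesis using assms(2) by simp
  next
    case False
    with 1(2) obtain c w1 r w2 where w: "c \<in> calls \<Sigma>" "r \<in> returns \<Sigma>" "w1 \<in> wn_words \<Sigma>"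
      "w2 \<in> wn_words \<Sigma>" "w = c # w1 @ r # w2"
      by (rule wn_words_decomp)
    then show ?thesis using 1(1) assms(3) by simp
  qed
qed

text \<open>The place of insertion always lies within one constituent of the derivation of
  \<open>x @ y\<close>, or at one of its borders, so \<open>z\<close> can be inserted there and the
  derivation rebuilt around it.\<close>

lemma wn_words_insert:
  assumes "x @ y \<in> wn_words \<Sigma>" "z \<in> wn_words \<Sigma>"
  shows "x @ z @ y \<in> wn_words \<Sigma>"
  using assms(1)
proof (induction "x @ y" arbitrary: x y rule: wn_words.induct)
  case empty
  then show ?case using assms(2) by simp
next
  case (append u v)
  then consider us where "u = x @ us" "us @ v = y" | us where "u @ us = x" "v = us @ y"
    by (auto simp: append_eq_append_conv2)
  then show ?case
  proof cases
    case 1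
    then have "(x @ z @ us) @ v \<in> wn_words \<Sigma>"
      using append by (intro wn_words.append[of "x @ z @ us"]) auto
    then show ?thesis using 1 by simp
  next
    case 2
    then have "u @ (us @ z @ y) \<in> wn_words \<Sigma>"
      using append by (intro wn_words.append[of u]) auto
    then show ?thesis using 2(1) by auto
  qed
next
  case (wrap w c r)
  \<comment> \<open>The cut lies before \<open>c\<close>, after \<open>r\<close>, or inside the
    pair; at the two ends \<open>z\<close> is simply concatenated, and only the inner cut calls for
    the induction hypothesis.\<close>
  consider "x = []" | "y = []" | x' y' where "x = c # x'" "y = y' @ [r]" "w = x' @ y'"
    using wrap.hyps(5) by (cases x; cases y rule: rev_cases) auto
  then show ?case
  proof cases
    case 1
    then show ?thesis
      using wrap.hyps wn_words.append[OF assms(2) wn_words.wrap[OF wrap.hyps(1,3,4)]] by simp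
  next
    case 2
    then show ?thesis
      using wrap.hyps wn_words.append[OF wn_words.wrap[OF wrap.hyps(1,3,4)] assms(2)] by simp
  next
    case 3
    then show ?thesis
      using wn_words.wrap[OF wrap.hyps(2)[of x' y'] wrap.hyps(3,4)] by simp
  qed
qed

section \<open>Runs: composition, change of the stack underneath, and splitting at matching
  returns\<close>

lemma is_vpt_callD:
  assumes "is_vpt \<Sigma> D A" "(p, a, \<gamma>, v, q) \<in> vpt_call A"
  shows "p \<in> vpt_states A" "a \<in> calls \<Sigma>" "\<gamma> \<in> vpt_stack A" "v \<in> lists D" "q \<in> vpt_states A"
  using assms unfolding is_vpt_def by blast+

lemma is_vpt_returnD:
  assumes "is_vpt \<Sigma> D A" "(p, a, \<gamma>, v, q) \<in> vpt_return A"
  shows "p \<in> vpt_states A" "a \<in> returns \<Sigma>" "\<gamma> \<in> vpt_stack A" "v \<in> lists D" "q \<in> vpt_states A"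
  using assms unfolding is_vpt_def by blast+

lemma run_append:
  assumes "run A C u v C'" "run A C' u' v' C''"
  shows "run A C (u @ u') (v @ v') C''"
  using assms by (induction rule: run.induct) (auto intro: run_call run_return)

text \<open>The bottom of the stack is never popped, so symbols placed underneath stay untouched.
  They have to be stack symbols because \<open>run_empty\<close> admits only members of
  \<open>configs A\<close>.\<close>

lemma run_weaken_stack:
  assumes "run A (p, \<sigma>) u v (q, \<tau>)" "\<rho> \<in> lists (vpt_stack A)"
  shows "run A (p, \<sigma> @ \<rho>) u v (q, \<tau> @ \<rho>)"
  using assms
proof (induction "(p, \<sigma>)" u v "(q, \<tau>)" arbitrary: p \<sigma> rule: run.induct)
  case run_empty
  then show ?case by (auto simp: configs_def intro!: run.run_empty)
qed (auto intro: run_call run_return)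

lemma run_states:
  assumes "is_vpt \<Sigma> D A" "run A (p, \<sigma>) u v C"
  shows "p \<in> vpt_states A"
  using assms(2)
  by cases (auto simp: configs_def dest: is_vpt_callD[OF assms(1)] is_vpt_returnD[OF assms(1)])

text \<open>Calls and returns are disjoint, so the letter read forces the kind of the first
  transition.\<close>

lemma run_call_cases:
  assumes "structured_alphabet \<Sigma>" "is_vpt \<Sigma> D A" "run A (p, \<sigma>) (c # u) v C" "c \<in> calls \<Sigma>"
  obtains \<gamma> v1 v2 p' where "(p, c, \<gamma>, v1, p') \<in> vpt_call A" "run A (p', \<gamma> # \<sigma>) u v2 C" "v = v1 @ v2"
  using assms(3)
proof cases
  case run_return
  then show ?thesis
    using assms(1,4) is_vpt_returnD(2)[OF assms(2)] by (fastforce simp: structured_alphabet_def)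
qed (use that in auto)

lemma run_return_cases:
  assumes "structured_alphabet \<Sigma>" "is_vpt \<Sigma> D A" "run A (p, \<gamma> # \<sigma>) (r # u) v C" "r \<in> returns \<Sigma>"
  obtains v1 v2 p' where "(p, r, \<gamma>, v1, p') \<in> vpt_return A" "run A (p', \<sigma>) u v2 C" "v = v1 @ v2"
  using assms(3)
proof cases
  case run_call
  then show ?thesis
    using assms(1,4) is_vpt_callD(2)[OF assms(2)] by (fastforce simp: structured_alphabet_def)
qed (use that in auto)

lemma run_Cons_append:
  assumes "is_vpt \<Sigma> D A" "(p, c, \<gamma>, v, p1) \<in> vpt_call A" "(q1, r, \<gamma>, v', q2) \<in> vpt_return A"
    and "run A (p1, []) w1 s1 (q1, [])" "run A (q2, []) w2 s2 C"
  shows "run A (p, []) (c # w1 @ r # w2) (v @ s1 @ v' @ s2) C"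
proof -
  have "run A (p1, [\<gamma>]) w1 s1 (q1, [\<gamma>])"
    using run_weaken_stack[OF assms(4), of "[\<gamma>]"] is_vpt_callD(3)[OF assms(1,2)] by simp
  then show ?thesis
    using run_append run_call[OF assms(2)] run_return[OF assms(3,5)] by metis
qed

text \<open>Every symbol pushed while reading \<open>w\<close> is popped by its matching return, so
  \<open>\<sigma>\<close> is left alone and the run on \<open>w\<close> can be replayed over the
  empty stack. The remainder \<open>u\<close> is arbitrary because the induction hypothesis for
  \<open>w1\<close> is used with \<open>r # w2 @ u\<close> still to be read.\<close>

lemma run_wn_split:
  assumes "structured_alphabet \<Sigma>" "is_vpt \<Sigma> D A" "w \<in> wn_words \<Sigma>"
    and "run A (p, \<sigma>) (w @ u) v C"
  shows "\<exists>q v1 v2. v = v1 @ v2 \<and> run A (p, []) w v1 (q, []) \<and> run A (q, \<sigma>) u v2 C"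
  using assms(3,4)
proof (induction w arbitrary: p \<sigma> u v rule: wn_words_induct_Cons)
  case Nil
  \<comment> \<open>The empty run is allowed only in a legal configuration; the given run supplies
    this for \<open>p\<close>.\<close>
  then have "p \<in> vpt_states A"
    using run_states[OF assms(2)] by blast
  then have "run A (p, []) [] [] (p, [])"
    by (auto simp: configs_def intro!: run_empty)
  with Nil show ?case by force
next
  case (Cons c r w1 w2)
  from Cons.prems have "run A (p, \<sigma>) (c # w1 @ r # w2 @ u) v C"
    by simp
  then obtain \<gamma> v1 v2 p1 where 1: "(p, c, \<gamma>, v1, p1) \<in> vpt_call A"
    "run A (p1, \<gamma> # \<sigma>) (w1 @ r # w2 @ u) v2 C" "v = v1 @ v2"
    using run_call_cases[OF assms(1,2) _ Cons.hyps(1)] by metis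
  \<comment> \<open>After \<open>w1\<close> the symbol \<open>\<gamma>\<close> is again on top, so
    the next return pops exactly what the call pushed.\<close>
  from Cons.IH(1)[OF 1(2)] obtain q1 s1 v3 where 2: "v2 = s1 @ v3"
    "run A (p1, []) w1 s1 (q1, [])" "run A (q1, \<gamma> # \<sigma>) (r # w2 @ u) v3 C"
    by blast
  from run_return_cases[OF assms(1,2) 2(3) Cons.hyps(2)] obtain v4 v5 q2 where
    3: "(q1, r, \<gamma>, v4, q2) \<in> vpt_return A" "run A (q2, \<sigma>) (w2 @ u) v5 C" "v3 = v4 @ v5"
    by metis
  from Cons.IH(2)[OF 3(2)] obtain q s2 v6 where 4: "v5 = s2 @ v6"
    "run A (q2, []) w2 s2 (q, [])" "run A (q, \<sigma>) u v6 C"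
    by blast
  have "v = (v1 @ s1 @ v4 @ s2) @ v6"
    using 1(3) 2(1) 3(3) 4(1) by simp
  with run_Cons_append[OF assms(2) 1(1) 3(1) 2(2) 4(2)] 4(3) show ?case by blast
qed

text \<open>This is the counterpart for runs of the node clause of \<open>hst_sem\<close>; both
  simulations compare the two clauses.\<close>

lemma run_Cons_append_iff:
  assumes "structured_alphabet \<Sigma>" "is_vpt \<Sigma> D A"
    and "c \<in> calls \<Sigma>" "r \<in> returns \<Sigma>" "w1 \<in> wn_words \<Sigma>"
  shows "run A (p, []) (c # w1 @ r # w2) s C \<longleftrightarrow>
    (\<exists>\<gamma> v p1 q1 v' q2 s1 s2. (p, c, \<gamma>, v, p1) \<in> vpt_call A \<and> (q1, r, \<gamma>, v', q2) \<in> vpt_return A \<and>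
       run A (p1, []) w1 s1 (q1, []) \<and> run A (q2, []) w2 s2 C \<and> s = v @ s1 @ v' @ s2)"
    (is "?L \<longleftrightarrow> ?R")
proof
  assume ?L
  then obtain \<gamma> v v2 p1 where 1: "(p, c, \<gamma>, v, p1) \<in> vpt_call A"
    "run A (p1, [\<gamma>]) (w1 @ r # w2) v2 C" "s = v @ v2"
    using run_call_cases[OF assms(1,2) _ assms(3)] by metis
  from run_wn_split[OF assms(1,2,5) 1(2)] obtain q1 s1 v3 where 2: "v2 = s1 @ v3"
    "run A (p1, []) w1 s1 (q1, [])" "run A (q1, [\<gamma>]) (r # w2) v3 C"
    by blast
  from run_return_cases[OF assms(1,2) 2(3) assms(4)] obtain v' s2 q2 where
    "(q1, r, \<gamma>, v', q2) \<in> vpt_return A" "run A (q2, []) w2 s2 C" "v3 = v' @ s2"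
    by metis
  with 1 2 show ?R by blast
next
  assume ?R
  then show ?L using run_Cons_append[OF assms(2)] by blast
qed

lemma run_Nil_iff: "run A (p, []) [] s (q, []) \<longleftrightarrow> p = q \<and> q \<in> vpt_states A \<and> s = []"
  by (subst run.simps) (auto simp: configs_def)

text \<open>The calls that pushed \<open>\<sigma>\<close> are not recorded in \<open>\<sigma>\<close>, so the induction is over statements for
  every word \<open>cs\<close> of calls of the right length.\<close>

lemma run_wn_words_aux:
  assumes "is_vpt \<Sigma> D A" "run A (p, \<sigma>) u v (q, [])"
    and "cs \<in> lists (calls \<Sigma>)" "length cs = length \<sigma>"
  shows "cs @ u \<in> wn_words \<Sigma>"
  using assms(2-)
proof (induction "(p, \<sigma>)" u v "(q, [] :: 'd list)" arbitrary: p \<sigma> cs rule: run.induct)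
  case run_empty
  then show ?case by (simp add: wn_words.empty)
next
  case (run_call p a \<gamma> v q' \<sigma> u v')
  then have "(cs @ [a]) @ u \<in> wn_words \<Sigma>"
    using is_vpt_callD(2)[OF assms(1)] by (intro run_call(3)) auto
  then show ?case by simp
next
  case (run_return p r \<gamma> v q' \<sigma> u v')
  \<comment> \<open>The return \<open>r\<close> closes the latest open call \<open>c\<close>. The
    induction hypothesis covers \<open>cs' @ u\<close>, and inserting the two-letter word of
    \<open>c\<close> and \<open>r\<close> gives the claim.\<close>
  then obtain cs' c where cs: "cs = cs' @ [c]"
    by (cases cs rule: rev_cases) auto
  with run_return have "cs' @ u \<in> wn_words \<Sigma>" by auto
  moreover have "c # [] @ [r] \<in> wn_words \<Sigma>"
    using run_return cs is_vpt_returnD(2)[OF assms(1)] by (intro wn_words.wrap wn_words.empty) auto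
  ultimately have "cs' @ (c # [] @ [r]) @ u \<in> wn_words \<Sigma>"
    by (rule wn_words_insert)
  then show ?case using cs by simp
qed

text \<open>Needed since \<open>comp_hedge\<close> demands a well-nested input explicitly, whereas
  \<open>vpt_rel\<close> does not.\<close>

lemma run_wn_words:
  assumes "is_vpt \<Sigma> D A" "run A (p, []) u v (q, [])"
  shows "u \<in> wn_words \<Sigma>"
  using run_wn_words_aux[OF assms, of "[]"] by simp

text \<open>As \<open>hedge\<close> maps the empty word to the empty hedge, this carries the
  condition on empty inputs across in both directions.\<close>

lemma accepts_comp_hedge_Nil: "accepts (comp_hedge \<Sigma> T) [] \<longleftrightarrow> accepts (hst_rel T) []"
  by (simp add: accepts_def comp_hedge_def wn_words.empty)


section \<open>From visibly pushdown transducers to hedge transducers\<close>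

text \<open>The state \<open>e (p, q)\<close> stands for the runs from \<open>p\<close> to
  \<open>q\<close> with empty stack at both ends. A rule guesses the state \<open>q1\<close> before
  the matching return and hands the target \<open>q\<close> on to the remaining hedge; the common
  \<open>\<gamma>\<close> ties the return to its call. The map \<open>e\<close> codes pairs of
  states in a freely chosen type.\<close>

definition hst_of_vpt :: "('q \<times> 'q \<Rightarrow> 's) \<Rightarrow> ('q, 'a, 'b, 'g) vpt \<Rightarrow> ('s, 'a \<times> 'a, 'b) hst" where
  "hst_of_vpt e A = \<lparr>
     hst_states = e ` (vpt_states A \<times> vpt_states A),
     hst_initial = e ` (vpt_initial A \<times> vpt_final A),
     hst_rules = {Eps_Rule (e (p, p)) | p. p \<in> vpt_states A} \<union>
       {Node_Rule (e (p, q)) (c, r) v (e (p1, q1)) v' (e (q2, q)) [] | p q c r v p1 q1 v' q2 \<gamma>.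
          q \<in> vpt_states A \<and> (p, c, \<gamma>, v, p1) \<in> vpt_call A \<and> (q1, r, \<gamma>, v', q2) \<in> vpt_return A}\<rparr>"

lemma Eps_Rule_hst_of_vpt:
  "Eps_Rule k \<in> hst_rules (hst_of_vpt e A) \<longleftrightarrow> (\<exists>p \<in> vpt_states A. k = e (p, p))"
  by (auto simp: hst_of_vpt_def)

lemma Node_Rule_hst_of_vpt:
  "Node_Rule k f w1 k1 w2 k2 w3 \<in> hst_rules (hst_of_vpt e A) \<longleftrightarrow>
   (\<exists>p q c r p1 q1 q2 \<gamma>. q \<in> vpt_states A \<and> (p, c, \<gamma>, w1, p1) \<in> vpt_call A \<and>
      (q1, r, \<gamma>, w2, q2) \<in> vpt_return A \<and> k = e (p, q) \<and> f = (c, r) \<and> k1 = e (p1, q1) \<and>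
      k2 = e (q2, q) \<and> w3 = [])"
  by (simp add: hst_of_vpt_def) blast

lemma is_hst_hst_of_vpt:
  assumes "is_vpt \<Sigma> D A"
  shows "is_hst (calls \<Sigma> \<times> returns \<Sigma>) D (hst_of_vpt e A)"
proof -
  have fin: "finite (vpt_states A)" "finite (vpt_call A)" "finite (vpt_return A)"
    and sub: "vpt_initial A \<subseteq> vpt_states A" "vpt_final A \<subseteq> vpt_states A"
    using assms by (auto simp: is_vpt_def)
  \<comment> \<open>For finiteness an upper bound is enough: the image ranges over all pairs of a
    call and a return, whether or not their stack symbols agree.\<close>
  have "hst_rules (hst_of_vpt e A) \<subseteq> (\<lambda>p. Eps_Rule (e (p, p))) ` vpt_states A \<union>
      (\<lambda>(q, (p, c, \<gamma>, v, p1), (q1, r, \<gamma>', v', q2)).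
         Node_Rule (e (p, q)) (c, r) v (e (p1, q1)) v' (e (q2, q)) []) `
      (vpt_states A \<times> vpt_call A \<times> vpt_return A)"
    unfolding hst_of_vpt_def by (force simp: image_iff)
  then have "finite (hst_rules (hst_of_vpt e A))"
    by (rule finite_subset) (use fin in auto)
  moreover have "finite (hst_states (hst_of_vpt e A))"
    "hst_initial (hst_of_vpt e A) \<subseteq> hst_states (hst_of_vpt e A)"
    using fin sub by (auto simp: hst_of_vpt_def)
  moreover have "hst_states (hst_of_vpt e A) = e ` (vpt_states A \<times> vpt_states A)"
    by (simp add: hst_of_vpt_def)
  ultimately show ?thesis
    unfolding is_hst_def Eps_Rule_hst_of_vpt Node_Rule_hst_of_vpt
    by (auto dest: is_vpt_callD[OF assms] is_vpt_returnD[OF assms])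
qed

text \<open>Along the decomposition of \<open>w\<close> both sides obey the same recursion: the
  rules pair a call and a return over one stack symbol, just as \<open>run_Cons_append_iff\<close>
  does.\<close>

lemma hst_sem_hst_of_vpt:
  assumes "structured_alphabet \<Sigma>" "is_vpt \<Sigma> D A"
    and "inj_on e (vpt_states A \<times> vpt_states A)"
    and "w \<in> wn_words \<Sigma>" "p \<in> vpt_states A" "q \<in> vpt_states A"
  shows "s \<in> hst_sem (hst_of_vpt e A) (e (p, q)) (hedge \<Sigma> w) \<longleftrightarrow> run A (p, []) w s (q, [])"
  using assms(4-)
proof (induction w arbitrary: p q s rule: wn_words_induct_Cons)
  case Nil
  then show ?case
    using assms(3) by (auto simp: run_Nil_iff Eps_Rule_hst_of_vpt inj_on_eq_iff)
next
  case (Cons c r w1 w2)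
  note cl = is_vpt_callD[OF assms(2)] and rt = is_vpt_returnD[OF assms(2)]
  \<comment> \<open>Injectivity ensures that a rule with left-hand state \<open>e (p, q)\<close>
    really stems from the pair of \<open>p\<close> and \<open>q\<close>.\<close>
  have e: "e (p, q) = e (p', q') \<longleftrightarrow> p = p' \<and> q = q'"
    if "p' \<in> vpt_states A" "q' \<in> vpt_states A" for p' q'
    using assms(3) Cons.prems that by (auto simp: inj_on_eq_iff)
  have "s \<in> hst_sem (hst_of_vpt e A) (e (p, q)) (hedge \<Sigma> (c # w1 @ r # w2)) \<longleftrightarrow>
    (\<exists>\<gamma> v p1 q1 v' q2 s1 s2. (p, c, \<gamma>, v, p1) \<in> vpt_call A \<and> (q1, r, \<gamma>, v', q2) \<in> vpt_return A \<and>
       s1 \<in> hst_sem (hst_of_vpt e A) (e (p1, q1)) (hedge \<Sigma> w1) \<and>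
       s2 \<in> hst_sem (hst_of_vpt e A) (e (q2, q)) (hedge \<Sigma> w2) \<and> s = v @ s1 @ v' @ s2)"
    (is "_ \<longleftrightarrow> ?R")
  proof
    assume "s \<in> hst_sem (hst_of_vpt e A) (e (p, q)) (hedge \<Sigma> (c # w1 @ r # w2))"
    then obtain v k1 v' k2 w3 s1 s2 where 1: "s = v @ s1 @ v' @ s2 @ w3"
      "Node_Rule (e (p, q)) (c, r) v k1 v' k2 w3 \<in> hst_rules (hst_of_vpt e A)"
      "s1 \<in> hst_sem (hst_of_vpt e A) k1 (hedge \<Sigma> w1)"
      "s2 \<in> hst_sem (hst_of_vpt e A) k2 (hedge \<Sigma> w2)"
      unfolding hedge_Cons[OF assms(1) Cons.hyps] by auto
    from 1(2) obtain p' q' p1 q1 q2 \<gamma> where 2: "q' \<in> vpt_states A" "(p', c, \<gamma>, v, p1) \<in> vpt_call A"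
      "(q1, r, \<gamma>, v', q2) \<in> vpt_return A" "e (p, q) = e (p', q')" "k1 = e (p1, q1)" "k2 = e (q2, q')"
      "w3 = []"
      unfolding Node_Rule_hst_of_vpt by auto
    then have "p' = p" "q' = q" using e cl(1) by auto
    moreover have "s = v @ s1 @ v' @ s2" using 1(1) 2(7) by simp
    ultimately show ?R using 1(3,4) 2(2,3,5,6) by blast
  next
    assume ?R
    then obtain \<gamma> v p1 q1 v' q2 s1 s2 where 1: "(p, c, \<gamma>, v, p1) \<in> vpt_call A"
      "(q1, r, \<gamma>, v', q2) \<in> vpt_return A"
      "s1 \<in> hst_sem (hst_of_vpt e A) (e (p1, q1)) (hedge \<Sigma> w1)"
      "s2 \<in> hst_sem (hst_of_vpt e A) (e (q2, q)) (hedge \<Sigma> w2)" "s = v @ s1 @ v' @ s2"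
      by blast
    have "Node_Rule (e (p, q)) (c, r) v (e (p1, q1)) v' (e (q2, q)) [] \<in> hst_rules (hst_of_vpt e A)"
      unfolding Node_Rule_hst_of_vpt using 1(1,2) Cons.prems(2) by blast
    moreover have "s = v @ s1 @ v' @ s2 @ []" using 1(5) by simp
    ultimately show "s \<in> hst_sem (hst_of_vpt e A) (e (p, q)) (hedge \<Sigma> (c # w1 @ r # w2))"
      unfolding hedge_Cons[OF assms(1) Cons.hyps] hst_sem.simps using 1(3,4) by blast
  qed
  also have "\<dots> \<longleftrightarrow> run A (p, []) (c # w1 @ r # w2) s (q, [])"
    unfolding run_Cons_append_iff[OF assms(1,2) Cons.hyps(1-3)]
    \<comment> \<open>The congruence provides the two transitions as assumptions; they show that
      \<open>p1\<close>, \<open>q1\<close> and \<open>q2\<close> are states, as the induction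
      hypotheses require.\<close>
    by (intro ex_cong1 conj_cong refl Cons.IH Cons.prems(2)) (erule cl(5) rt(1) rt(5))+
  finally show ?case .
qed

lemma vpt_rel_hst_of_vpt:
  assumes "structured_alphabet \<Sigma>" "is_vpt \<Sigma> D A"
    and "inj_on e (vpt_states A \<times> vpt_states A)"
  shows "vpt_rel A = comp_hedge \<Sigma> (hst_of_vpt e A)"
proof -
  have "vpt_initial A \<subseteq> vpt_states A" "vpt_final A \<subseteq> vpt_states A"
    using assms(2) by (auto simp: is_vpt_def)
  moreover have "hst_initial (hst_of_vpt e A) = e ` (vpt_initial A \<times> vpt_final A)"
    by (simp add: hst_of_vpt_def)
  ultimately have "(w, s) \<in> vpt_rel A \<longleftrightarrow> (w, s) \<in> comp_hedge \<Sigma> (hst_of_vpt e A)" for w s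
    using hst_sem_hst_of_vpt[OF assms, of w] run_wn_words[OF assms(2), of _ w s]
    unfolding vpt_rel_def comp_hedge_def hst_rel_def by (simp add: Bex_def) blast
  then show ?thesis by auto
qed


section \<open>From hedge transducers to visibly pushdown transducers\<close>

text \<open>The third output word of a node rule is ignored, as it is empty in a tail-recursive
  transducer.\<close>

definition vpt_of_hst ::
  "('s \<Rightarrow> 'q) \<Rightarrow> (('s, 'a \<times> 'a, 'b) hst_rule \<Rightarrow> 'g) \<Rightarrow> ('s, 'a \<times> 'a, 'b) hst \<Rightarrow> ('q, 'a, 'b, 'g) vpt" where
  "vpt_of_hst e g T = \<lparr>
     vpt_states = e ` hst_states T,
     vpt_initial = e ` hst_initial T,
     vpt_final = e ` {p. Eps_Rule p \<in> hst_rules T},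
     vpt_stack = g ` hst_rules T,
     vpt_call = {(e q, c, g (Node_Rule q (c, r) w1 q1 w2 q2 w3), w1, e q1) | q c r w1 q1 w2 q2 w3.
       Node_Rule q (c, r) w1 q1 w2 q2 w3 \<in> hst_rules T},
     vpt_return = {(e p, r, g (Node_Rule q (c, r) w1 q1 w2 q2 w3), w2, e q2) | p q c r w1 q1 w2 q2 w3.
       Eps_Rule p \<in> hst_rules T \<and> Node_Rule q (c, r) w1 q1 w2 q2 w3 \<in> hst_rules T}\<rparr>"

lemma vpt_call_vpt_of_hst:
  "(k, c, \<gamma>, w1, k1) \<in> vpt_call (vpt_of_hst e g T) \<longleftrightarrow>
   (\<exists>q r q1 w2 q2 w3. Node_Rule q (c, r) w1 q1 w2 q2 w3 \<in> hst_rules T \<and> k = e q \<and>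
      \<gamma> = g (Node_Rule q (c, r) w1 q1 w2 q2 w3) \<and> k1 = e q1)"
  by (simp add: vpt_of_hst_def) blast

lemma vpt_return_vpt_of_hst:
  "(k, r, \<gamma>, w2, k2) \<in> vpt_return (vpt_of_hst e g T) \<longleftrightarrow>
   (\<exists>p q c w1 q1 q2 w3. Eps_Rule p \<in> hst_rules T \<and> Node_Rule q (c, r) w1 q1 w2 q2 w3 \<in> hst_rules T \<and>
      k = e p \<and> \<gamma> = g (Node_Rule q (c, r) w1 q1 w2 q2 w3) \<and> k2 = e q2)"
  by (simp add: vpt_of_hst_def) blast

lemma is_hst_Node_RuleD:
  assumes "is_hst \<Lambda> D T" "Node_Rule q f w1 q1 w2 q2 w3 \<in> hst_rules T"
  shows "q \<in> hst_states T" "q1 \<in> hst_states T" "q2 \<in> hst_states T" "f \<in> \<Lambda>" "w1 \<in> lists D"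
    "w2 \<in> lists D" "w3 \<in> lists D"
  using assms unfolding is_hst_def by blast+

lemma is_vpt_vpt_of_hst:
  assumes "is_hst (calls \<Sigma> \<times> returns \<Sigma>) D T"
  shows "is_vpt \<Sigma> D (vpt_of_hst e g T)"
proof -
  let ?A = "vpt_of_hst e g T"
  have fin: "finite (hst_states T)" "finite (hst_rules T)"
    and sub: "hst_initial T \<subseteq> hst_states T" "\<And>p. Eps_Rule p \<in> hst_rules T \<Longrightarrow> p \<in> hst_states T"
    using assms by (auto simp: is_hst_def)
  \<comment> \<open>A call transition is determined by the rule it applies. On an epsilon rule the
    case expression is unspecified, which is harmless for an upper bound.\<close>
  let ?call = "\<lambda>\<rho>. case \<rho> of Node_Rule q (c, r) w1 q1 w2 q2 w3 \<Rightarrow> (e q, c, g \<rho>, w1, e q1)"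
  have "vpt_call ?A \<subseteq> ?call ` hst_rules T"
    unfolding vpt_of_hst_def by (force simp: image_iff)
  then have "finite (vpt_call ?A)"
    by (rule finite_subset) (use fin in auto)
  \<comment> \<open>A return depends also on the state \<open>p\<close> that it leaves, hence the
    product with the set of states.\<close>
  moreover let ?ret = "\<lambda>(p, \<rho>). case \<rho> of Node_Rule q (c, r) w1 q1 w2 q2 w3 \<Rightarrow> (e p, r, g \<rho>, w2, e q2)"
  have "vpt_return ?A \<subseteq> ?ret ` (hst_states T \<times> hst_rules T)"
    unfolding vpt_of_hst_def using sub(2) by (force simp: image_iff)
  then have "finite (vpt_return ?A)"
    by (rule finite_subset) (use fin in auto)
  moreover have "vpt_call ?A \<subseteq> vpt_states ?A \<times> calls \<Sigma> \<times> vpt_stack ?A \<times> lists D \<times> vpt_states ?A"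
    "vpt_return ?A \<subseteq> vpt_states ?A \<times> returns \<Sigma> \<times> vpt_stack ?A \<times> lists D \<times> vpt_states ?A"
    using sub(2) is_hst_Node_RuleD[OF assms] unfolding vpt_of_hst_def by (clarsimp; blast)+
  moreover have "finite (vpt_states ?A)" "finite (vpt_stack ?A)" "vpt_initial ?A \<subseteq> vpt_states ?A"
    "vpt_final ?A \<subseteq> vpt_states ?A"
    using fin sub by (auto simp: vpt_of_hst_def)
  ultimately show ?thesis
    unfolding is_vpt_def by blast
qed

text \<open>By injectivity of \<open>g\<close>, a call and a return with the same stack symbol come
  from the same rule. Their outputs are its first two words, and its third is empty.\<close>

lemma well_nested_vpt_of_hst:
  assumes "hedge_to_hedge \<Delta> T" "tail_recursive T" "inj_on g (hst_rules T)"
  shows "well_nested \<Delta> (vpt_of_hst e g T)"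
  unfolding well_nested_def
proof (intro ballI allI impI)
  fix \<gamma> k c v k' l r v' l'
  assume "(k, c, \<gamma>, v, k') \<in> vpt_call (vpt_of_hst e g T)"
    and "(l, r, \<gamma>, v', l') \<in> vpt_return (vpt_of_hst e g T)"
  then obtain q r' q1 w2 q2 w3 p c' w1 q1' q2' w3' where
    1: "Node_Rule q (c, r') v q1 w2 q2 w3 \<in> hst_rules T" "\<gamma> = g (Node_Rule q (c, r') v q1 w2 q2 w3)"
    "Node_Rule p (c', r) w1 q1' v' q2' w3' \<in> hst_rules T" "\<gamma> = g (Node_Rule p (c', r) w1 q1' v' q2' w3')"
    unfolding vpt_call_vpt_of_hst vpt_return_vpt_of_hst by (elim exE conjE)
  then have "w2 = v'"
    using assms(3) by (auto simp: inj_on_eq_iff)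
  moreover have "w3 = []"
    using 1 assms(2) unfolding tail_recursive_def by blast
  moreover have "v @ w2 @ w3 \<in> wn_words \<Delta>"
    using 1 assms(1) unfolding hedge_to_hedge_def by blast
  ultimately show "v @ v' \<in> wn_words \<Delta>" by simp
qed

text \<open>Processing a hedge ends with an epsilon rule, so the simulating run ends in some state
  \<open>e p\<close> where \<open>p\<close> has such a rule. Which \<open>p\<close> it is does not
  matter, since the continuation is read off the stack.\<close>

lemma hst_sem_vpt_of_hst:
  assumes "structured_alphabet \<Sigma>" "is_hst (calls \<Sigma> \<times> returns \<Sigma>) D T" "tail_recursive T"
    and "inj_on e (hst_states T)" "inj_on g (hst_rules T)"
    and "w \<in> wn_words \<Sigma>" "q \<in> hst_states T"
  shows "s \<in> hst_sem T q (hedge \<Sigma> w) \<longleftrightarrow>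
    (\<exists>p. Eps_Rule p \<in> hst_rules T \<and> run (vpt_of_hst e g T) (e q, []) w s (e p, []))"
  using assms(6-)
proof (induction w arbitrary: q s rule: wn_words_induct_Cons)
  case Nil
  moreover have "p \<in> hst_states T" if "Eps_Rule p \<in> hst_rules T" for p
    using that assms(2) by (auto simp: is_hst_def)
  moreover have "vpt_states (vpt_of_hst e g T) = e ` hst_states T"
    by (simp add: vpt_of_hst_def)
  ultimately show ?case
    using assms(4) by (auto simp: run_Nil_iff inj_on_eq_iff)
next
  case (Cons c r w1 w2)
  let ?A = "vpt_of_hst e g T"
  note rule = is_hst_Node_RuleD[OF assms(2)]
  note run_iff = run_Cons_append_iff[OF assms(1) is_vpt_vpt_of_hst[OF assms(2)] Cons.hyps(1-3)]
  show ?case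
  proof
    assume "s \<in> hst_sem T q (hedge \<Sigma> (c # w1 @ r # w2))"
    then obtain v q1 v' q2 w3 s1 s2 where 1: "s = v @ s1 @ v' @ s2 @ w3"
      "Node_Rule q (c, r) v q1 v' q2 w3 \<in> hst_rules T"
      "s1 \<in> hst_sem T q1 (hedge \<Sigma> w1)" "s2 \<in> hst_sem T q2 (hedge \<Sigma> w2)"
      unfolding hedge_Cons[OF assms(1) Cons.hyps] by auto
    have "w3 = []"
      using 1(2) assms(3) unfolding tail_recursive_def by blast
    \<comment> \<open>The run on \<open>w1\<close> ends in a state with an epsilon rule, which is
      where a return transition may start.\<close>
    obtain p1 where p1: "Eps_Rule p1 \<in> hst_rules T" "run ?A (e q1, []) w1 s1 (e p1, [])"
      using 1(3) Cons.IH(1) rule(2)[OF 1(2)] by blast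
    obtain p where p: "Eps_Rule p \<in> hst_rules T" "run ?A (e q2, []) w2 s2 (e p, [])"
      using 1(4) Cons.IH(2) rule(3)[OF 1(2)] by blast
    let ?\<gamma> = "g (Node_Rule q (c, r) v q1 v' q2 w3)"
    have "(e q, c, ?\<gamma>, v, e q1) \<in> vpt_call ?A"
      using 1(2) unfolding vpt_call_vpt_of_hst by blast
    moreover have "(e p1, r, ?\<gamma>, v', e q2) \<in> vpt_return ?A"
      using 1(2) p1(1) unfolding vpt_return_vpt_of_hst by blast
    ultimately have "run ?A (e q, []) (c # w1 @ r # w2) s (e p, [])"
      unfolding run_iff 1(1) \<open>w3 = []\<close> append_Nil2 using p1(2) p(2) by blast
    then show "\<exists>p. Eps_Rule p \<in> hst_rules T \<and> run ?A (e q, []) (c # w1 @ r # w2) s (e p, [])"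
      using p(1) by blast
  next
    assume "\<exists>p. Eps_Rule p \<in> hst_rules T \<and> run ?A (e q, []) (c # w1 @ r # w2) s (e p, [])"
    then obtain p \<gamma> v k1 l1 v' k2 s1 s2 where 1: "Eps_Rule p \<in> hst_rules T"
      "(e q, c, \<gamma>, v, k1) \<in> vpt_call ?A" "(l1, r, \<gamma>, v', k2) \<in> vpt_return ?A"
      "run ?A (k1, []) w1 s1 (l1, [])" "run ?A (k2, []) w2 s2 (e p, [])" "s = v @ s1 @ v' @ s2"
      unfolding run_iff by blast
    from 1(2) obtain q' r' q1 x q2 w3 where 2: "Node_Rule q' (c, r') v q1 x q2 w3 \<in> hst_rules T"
      "e q = e q'" "\<gamma> = g (Node_Rule q' (c, r') v q1 x q2 w3)" "k1 = e q1"
      unfolding vpt_call_vpt_of_hst by blast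
    from 1(3) obtain p1 q'' c'' y q1'' q2'' z where 3: "Eps_Rule p1 \<in> hst_rules T"
      "Node_Rule q'' (c'', r) y q1'' v' q2'' z \<in> hst_rules T" "l1 = e p1"
      "\<gamma> = g (Node_Rule q'' (c'', r) y q1'' v' q2'' z)" "k2 = e q2''"
      unfolding vpt_return_vpt_of_hst by blast
    \<comment> \<open>Call and return share \<open>\<gamma>\<close>, so injectivity of
      \<open>g\<close> identifies the two rules and fixes both the second output word and the
      continuation.\<close>
    have eq: "r' = r" "x = v'" "q2'' = q2"
      using 2(1,3) 3(2,4) assms(5) by (auto simp: inj_on_eq_iff)
    have "q' = q"
      using 2(2) rule(1)[OF 2(1)] Cons.prems assms(4) by (auto simp: inj_on_eq_iff)
    have "s1 \<in> hst_sem T q1 (hedge \<Sigma> w1)"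
      using 1(4) 2(4) 3(1,3) Cons.IH(1) rule(2)[OF 2(1)] by blast
    moreover have "s2 \<in> hst_sem T q2 (hedge \<Sigma> w2)"
      using 1(1,5) 3(5) eq Cons.IH(2) rule(3)[OF 2(1)] by blast
    moreover have "Node_Rule q (c, r) v q1 v' q2 [] \<in> hst_rules T"
      using 2(1) eq(1,2) \<open>q' = q\<close> assms(3) unfolding tail_recursive_def by blast
    moreover have "s = v @ s1 @ v' @ s2 @ []"
      using 1(6) by simp
    ultimately show "s \<in> hst_sem T q (hedge \<Sigma> (c # w1 @ r # w2))"
      unfolding hedge_Cons[OF assms(1) Cons.hyps] hst_sem.simps by blast
  qed
qed

lemma vpt_rel_vpt_of_hst:
  assumes "structured_alphabet \<Sigma>" "is_hst (calls \<Sigma> \<times> returns \<Sigma>) D T" "tail_recursive T"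
    and "inj_on e (hst_states T)" "inj_on g (hst_rules T)"
  shows "vpt_rel (vpt_of_hst e g T) = comp_hedge \<Sigma> T"
proof -
  have sub: "hst_initial T \<subseteq> hst_states T"
    using assms(2) by (auto simp: is_hst_def)
  have "(w, s) \<in> vpt_rel (vpt_of_hst e g T) \<longleftrightarrow> (w, s) \<in> comp_hedge \<Sigma> T" for w s
  proof -
    let ?A = "vpt_of_hst e g T"
    have "(w, s) \<in> vpt_rel ?A \<longleftrightarrow>
        (\<exists>q \<in> hst_initial T. \<exists>p. Eps_Rule p \<in> hst_rules T \<and> run ?A (e q, []) w s (e p, []))"
      by (simp add: vpt_rel_def vpt_of_hst_def)
    also have "\<dots> \<longleftrightarrow> w \<in> wn_words \<Sigma> \<and> (\<exists>q \<in> hst_initial T. s \<in> hst_sem T q (hedge \<Sigma> w))"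
      using hst_sem_vpt_of_hst[OF assms, of w _ s] run_wn_words[OF is_vpt_vpt_of_hst[OF assms(2)]] sub
      by (meson subsetD)
    finally show ?thesis
      by (simp add: comp_hedge_def hst_rel_def)
  qed
  then show ?thesis by auto
qed

section \<open>Equal expressiveness, with the constructed states and stack symbols coded by natural
  numbers\<close>

theorem lemma4:
  fixes \<Sigma> :: "'a salph" and \<Delta> :: "'b salph"
  assumes "structured_alphabet \<Sigma>" and "structured_alphabet \<Delta>"
  shows "(\<forall>A :: ('q, 'a, 'b, 'g) vpt.
            is_vpt \<Sigma> (symbols \<Delta>) A \<and> well_nested \<Delta> A \<and> \<not> accepts (vpt_rel A) [] \<longrightarrow>
            (\<exists>T :: (nat, 'a \<times> 'a, 'b) hst.
               is_hst (calls \<Sigma> \<times> returns \<Sigma>) (symbols \<Delta>) T \<and> hedge_to_hedge \<Delta> T \<and>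
               tail_recursive T \<and> \<not> accepts (hst_rel T) [] \<and> vpt_rel A = comp_hedge \<Sigma> T)) \<and>
         (\<forall>T :: ('p, 'a \<times> 'a, 'b) hst.
            is_hst (calls \<Sigma> \<times> returns \<Sigma>) (symbols \<Delta>) T \<and> hedge_to_hedge \<Delta> T \<and>
            tail_recursive T \<and> \<not> accepts (hst_rel T) [] \<longrightarrow>
            (\<exists>A :: (nat, 'a, 'b, nat) vpt.
               is_vpt \<Sigma> (symbols \<Delta>) A \<and> well_nested \<Delta> A \<and> \<not> accepts (vpt_rel A) [] \<and>
               vpt_rel A = comp_hedge \<Sigma> T))"
proof (intro conjI allI impI; elim conjE)
  fix A :: "('q, 'a, 'b, 'g) vpt"
  assume A: "is_vpt \<Sigma> (symbols \<Delta>) A" "well_nested \<Delta> A" "\<not> accepts (vpt_rel A) []"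
  then have "finite (vpt_states A \<times> vpt_states A)"
    by (simp add: is_vpt_def)
  then obtain e :: "'q \<times> 'q \<Rightarrow> nat" where e: "inj_on e (vpt_states A \<times> vpt_states A)"
    using finite_imp_inj_to_nat_seg by blast
  let ?T = "hst_of_vpt e A"
  have rel: "vpt_rel A = comp_hedge \<Sigma> ?T"
    by (rule vpt_rel_hst_of_vpt[OF assms(1) A(1) e])
  \<comment> \<open>The words of a rule are the outputs of a call and a return over one
    \<open>\<gamma>\<close>, followed by the empty word; that \<open>\<gamma>\<close> is a stack
    symbol, as \<open>well_nested\<close> asks, follows from the call.\<close>
  moreover have "hedge_to_hedge \<Delta> ?T"
    using A(2) is_vpt_callD(3)[OF A(1)]
    unfolding hedge_to_hedge_def well_nested_def Node_Rule_hst_of_vpt by fastforce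
  moreover have "tail_recursive ?T"
    unfolding tail_recursive_def Node_Rule_hst_of_vpt by blast
  moreover have "\<not> accepts (hst_rel ?T) []"
    using A(3) rel accepts_comp_hedge_Nil by metis
  ultimately show "\<exists>T :: (nat, 'a \<times> 'a, 'b) hst.
      is_hst (calls \<Sigma> \<times> returns \<Sigma>) (symbols \<Delta>) T \<and> hedge_to_hedge \<Delta> T \<and>
      tail_recursive T \<and> \<not> accepts (hst_rel T) [] \<and> vpt_rel A = comp_hedge \<Sigma> T"
    using is_hst_hst_of_vpt[OF A(1)] by blast
next
  fix T :: "('p, 'a \<times> 'a, 'b) hst"
  assume T: "is_hst (calls \<Sigma> \<times> returns \<Sigma>) (symbols \<Delta>) T" "hedge_to_hedge \<Delta> T"
    "tail_recursive T" "\<not> accepts (hst_rel T) []"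
  then have "finite (hst_states T)" "finite (hst_rules T)"
    by (simp_all add: is_hst_def)
  then obtain e :: "'p \<Rightarrow> nat" and g :: "('p, 'a \<times> 'a, 'b) hst_rule \<Rightarrow> nat"
    where inj: "inj_on e (hst_states T)" "inj_on g (hst_rules T)"
    using finite_imp_inj_to_nat_seg by metis
  let ?A = "vpt_of_hst e g T"
  have rel: "vpt_rel ?A = comp_hedge \<Sigma> T"
    by (rule vpt_rel_vpt_of_hst[OF assms(1) T(1,3) inj])
  moreover have "\<not> accepts (vpt_rel ?A) []"
    using T(4) rel accepts_comp_hedge_Nil by metis
  ultimately show "\<exists>A :: (nat, 'a, 'b, nat) vpt. is_vpt \<Sigma> (symbols \<Delta>) A \<and> well_nested \<Delta> A \<and>
      \<not> accepts (vpt_rel A) [] \<and> vpt_rel A = comp_hedge \<Sigma> T"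
    using is_vpt_vpt_of_hst[OF T(1)] well_nested_vpt_of_hst[OF T(2,3) inj(2)] by blast
qed

end
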